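(* Let $n\geqslant 0$. The map $T \mapsto (\mathcal{R},\mathcal{R}')$, which sends a tricolored tree $T$ with $n+1$ nodes to the pair of transfer systems on $[n]$ determined by the functions $\pi_{\mathcal{R}},\pi_{\mathcal{R}'}$ constructed from the admissible ordering of $T$ (as defined in the context), is a bijection between tricolored trees with $n+1$ nodes and Kreweras pairs $\mathcal{R}\preccurlyeq\mathcal{R}'$ of transfer systems on $[n]$. Under this bijection, a tricolored tree represents a model structure (i.e. the associated pair $(\mathcal{R},\mathcal{R}')$ is a model structure on $[n]$) if and only if the tree does not have a red branch descended from any non-red branch.
   Context: Transfer systems. $[n]=\{0<1<\cdots<n\}$, viewed as a category with one morphism $x\to y$ when $x\leqslant y$. A transfer system on $[n]$ is a partial order $\mathcal{R}$ on $\{0,\dots,n\}$ such that $x\,\mathcal{R}\,y$ implies $x\leqslant y$, and if $x\,\mathcal{R}\,y$, $z\leqslant y$ then $\min(x,z)\,\mathcal{R}\,z$. $\mathcal{R}\leqslant\mathcal{R}'$ means $x\,\mathcal{R}\,y\Rightarrow x\,\mathcal{R}'\,y$. The left class $\mathcal{L}'$ of $\mathcal{R}'$: $x\,\mathcal{L}'\,y$ iff $x\leqslant y$ and for all $a\,\mathcal{R}'\,b$ with $x\leqslant a$, $y\leqslant b$ one has $y\leqslant a$. $\mathcal{R}\circ\mathcal{L}'$ is the set of morphisms $x\to y$ with $x\,\mathcal{L}'\,z\,\mathcal{R}\,y$ for some $z$. $\pi_{\mathcal{R}}(i)$ is the maximal $j$ with $i\,\mathcal{R}\,j$; $\mathcal{R}$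 is determined by $\pi_{\mathcal{R}}$ via $i\,\mathcal{R}\,j \iff i\leqslant j\leqslant\pi_{\mathcal{R}}(i)$. A Kreweras pair $\mathcal{R}\preccurlyeq\mathcal{R}'$ is a pair of transfer systems such that $\pi_{\mathcal{R}}(i)=\pi_{\mathcal{R}}(j)$ implies $\pi_{\mathcal{R}'}(i)=\pi_{\mathcal{R}'}(j)$ for all $i,j$ (equivalently, $\mathcal{R}\leqslant\mathcal{R}'$ and $\mathcal{R}\circ\mathcal{L}'$ is closed under composition). A pair $\mathcal{R}\leqslant\mathcal{R}'$ is a model structure if $\mathcal{W}=\mathcal{R}\circ\mathcal{L}'$ satisfies two-out-of-three: for composable $f,g$, if two of $f,g,f\circ g$ are in $\mathcal{W}$ then so is the third. Trees. A tricolored tree is a finite rooted planar tree whose edges (branches) are colored blue, green or red, each node having at most one child of each color; a branch $x\to y$ goes from a parent $x$ to its child $y$. The tree is admissibly ordered by labelling its $n+1$ nodes $0,\dots,n$ by inorder traversal: for each node, first its blue subtree, then the node itself, then its green subtree, then its red subtree. Nodes are identified with their labels. Write $x\sim_T y$ if the path connecting $x$ and $y$ uses only red and green edges. Every node is a descendant of itself. Construction: $\pi_{\mathcal{R}'}(x)$ is the maximal $y$ with $y\sim_T x$; $\pi_{\mathcal{R}}(x)=x$ if $x$ has no green child, and otherwise $\pi_{\mathcal{R}}(x)$ is the maximal (right-most) descendant of the green child of $x$. A red branch $x\to y$ is descended from a non-red (blue or green) branch $u\to v$ if $x$ is a descendant of $v$. *)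

theory Defs
  imports Main
begin

section \<open>Transfer systems on the total order \<open>0 < \<dots> < n\<close>\<close>

definition transfer_system :: "nat \<Rightarrow> nat rel \<Rightarrow> bool" where
  "transfer_system n R \<longleftrightarrow>
     partial_order_on {0..n} R \<and>
     (\<forall>x y. (x, y) \<in> R \<longrightarrow> x \<le> y) \<and>
     (\<forall>x y z. (x, y) \<in> R \<longrightarrow> z \<le> y \<longrightarrow> (min x z, z) \<in> R)"

definition transfer_max :: "nat rel \<Rightarrow> nat \<Rightarrow> nat" where
  "transfer_max R i = Max {j. (i, j) \<in> R}"

definition rel_of_max :: "nat \<Rightarrow> (nat \<Rightarrow> nat) \<Rightarrow> nat rel" where
  "rel_of_max n p = {(i, j). i \<le> n \<and> i \<le> j \<and> j \<le> p i}"

definition kreweras_pair :: "nat \<Rightarrow> nat rel \<Rightarrow> nat rel \<Rightarrow> bool" where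
  "kreweras_pair n R R' \<longleftrightarrow>
     transfer_system n R \<and> transfer_system n R' \<and>
     (\<forall>i\<le>n. \<forall>j\<le>n. transfer_max R i = transfer_max R j \<longrightarrow> transfer_max R' i = transfer_max R' j)"

definition left_class :: "nat \<Rightarrow> nat rel \<Rightarrow> nat rel" where
  "left_class n R' =
     {(x, y). x \<le> y \<and> y \<le> n \<and> (\<forall>a b. (a, b) \<in> R' \<longrightarrow> x \<le> a \<longrightarrow> y \<le> b \<longrightarrow> y \<le> a)}"

text \<open>Morphisms compose from right to left in the paper, so the weak equivalences
  \<open>R \<circ> L'\<close> become \<open>L' O R\<close>, the pairs \<open>(x, y)\<close> with
  \<open>(x, z) \<in> L'\<close> and \<open>(z, y) \<in> R\<close> for some \<open>z\<close>.\<close>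

definition weak_equivs :: "nat \<Rightarrow> nat rel \<Rightarrow> nat rel \<Rightarrow> nat rel" where
  "weak_equivs n R R' = left_class n R' O R"

definition two_out_of_three :: "nat \<Rightarrow> nat rel \<Rightarrow> bool" where
  "two_out_of_three n W \<longleftrightarrow>
     (\<forall>x y z. x \<le> y \<longrightarrow> y \<le> z \<longrightarrow> z \<le> n \<longrightarrow>
        ((x, y) \<in> W \<and> (y, z) \<in> W \<longrightarrow> (x, z) \<in> W) \<and>
        ((x, y) \<in> W \<and> (x, z) \<in> W \<longrightarrow> (y, z) \<in> W) \<and>
        ((y, z) \<in> W \<and> (x, z) \<in> W \<longrightarrow> (x, y) \<in> W))"

definition model_structure :: "nat \<Rightarrow> nat rel \<Rightarrow> nat rel \<Rightarrow> bool" where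
  "model_structure n R R' \<longleftrightarrow>
     transfer_system n R \<and> transfer_system n R' \<and> R \<subseteq> R' \<and>
     two_out_of_three n (weak_equivs n R R')"

section \<open>Tricolored trees\<close>

datatype color = Blue | Green | Red

text \<open>\<open>Empty\<close> stands for a missing child, and the arguments of \<open>Node\<close> are the
  blue, green and red subtrees. A tricolored tree in the sense of the paper is a nonempty
  value of this type, that is, one with at least one node.\<close>

datatype tricolored_tree = Empty | Node tricolored_tree tricolored_tree tricolored_tree

text \<open>A node is given by its address, the list of colors on the path from the root to it.
  The label of a node in the admissible ordering is its position in \<open>inorder T\<close>.\<close>

primrec inorder :: "tricolored_tree \<Rightarrow> color list list" where
  "inorder Empty = []"
| "inorder (Node b g r) =
     map ((#) Blue) (inorder b) @ [[]] @ map ((#) Green) (inorder g) @ map ((#) Red) (inorder r)"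

definition num_nodes :: "tricolored_tree \<Rightarrow> nat" where
  "num_nodes T = length (inorder T)"

text \<open>\<open>branch T x c y\<close>: there is a branch of color \<open>c\<close> from the parent labelled \<open>x\<close>
  to the child labelled \<open>y\<close>.\<close>

definition branch :: "tricolored_tree \<Rightarrow> nat \<Rightarrow> color \<Rightarrow> nat \<Rightarrow> bool" where
  "branch T x c y \<longleftrightarrow>
     x < num_nodes T \<and> y < num_nodes T \<and> inorder T ! y = inorder T ! x @ [c]"

text \<open>\<open>descendant T x y\<close>: the node \<open>y\<close> is a descendant of the node \<open>x\<close>.\<close>

definition descendant :: "tricolored_tree \<Rightarrow> nat \<Rightarrow> nat \<Rightarrow> bool" where
  "descendant T = (\<lambda>x y. \<exists>c. branch T x c y)\<^sup>*\<^sup>*"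

text \<open>In a tree the path between two nodes is unique, and every walk between them uses all
  of its edges. Hence the path avoids blue edges iff some walk does.\<close>

definition red_green_connected :: "tricolored_tree \<Rightarrow> nat \<Rightarrow> nat \<Rightarrow> bool" where
  "red_green_connected T = equivclp (\<lambda>x y. branch T x Red y \<or> branch T x Green y)"

definition tree_max' :: "tricolored_tree \<Rightarrow> nat \<Rightarrow> nat" where
  "tree_max' T x = Max {y. red_green_connected T y x}"

definition tree_max :: "tricolored_tree \<Rightarrow> nat \<Rightarrow> nat" where
  "tree_max T x =
     (if \<exists>y. branch T x Green y
      then Max {z. \<exists>y. branch T x Green y \<and> descendant T y z}
      else x)"

definition tree_pair :: "nat \<Rightarrow> tricolored_tree \<Rightarrow> nat rel \<times> nat rel" where
  "tree_pair n T = (rel_of_max n (tree_max T), rel_of_max n (tree_max' T))"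

definition has_red_descended_from_nonred :: "tricolored_tree \<Rightarrow> bool" where
  "has_red_descended_from_nonred T \<longleftrightarrow>
     (\<exists>x y u v c. branch T x Red y \<and> branch T u c v \<and> c \<noteq> Red \<and> descendant T v x)"

end

theory Submission
  imports Defs
begin

text \<open>Both functions are recursive in the tree. Let the blue, green and red subtrees of the root
  have \<open>B\<close>, \<open>G\<close> and \<open>D\<close> nodes. Then the root is \<open>B\<close>, its component without blue branches
  contains the last node, and its green subtree ends at \<open>B + G\<close>. Conversely, for a Kreweras pair
  the root is recovered as the least \<open>x\<close> with \<open>\<pi>' x = n\<close>, and \<open>B + G\<close> as its image under \<open>\<pi>\<close>.
  The restrictions to the three intervals, with values cut off at the right ends, are again Kreweras
  pairs, so the tree is reconstructed by recursion.

  The weak equivalences of the tree are those of the three subtrees together with all \<open>x \<rightarrow> y\<close> with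
  \<open>x \<le> B \<le> y \<le> B + G\<close>. Hence two-out-of-three holds iff it holds for the red subtree and all
  morphisms within the blue subtree and within the green one are weak equivalences, and all morphisms
  are weak equivalences iff there is no red branch.\<close>

section \<open>Branches of a tree\<close>

lemma num_nodes_simps [simp]:
  "num_nodes Empty = 0"
  "num_nodes (Node b g r) = Suc (num_nodes b + num_nodes g + num_nodes r)"
  by (simp_all add: num_nodes_def)

lemma num_nodes_eq_0_iff [simp]: "num_nodes T = 0 \<longleftrightarrow> T = Empty"
  by (cases T) simp_all

lemma less_num_nodes_imp_nonempty: "x < num_nodes T \<Longrightarrow> T \<noteq> Empty"
  by auto

fun root :: "tricolored_tree \<Rightarrow> nat" where
  "root Empty = 0"
| "root (Node b g r) = num_nodes b"

lemma root_less: "T \<noteq> Empty \<Longrightarrow> root T < num_nodes T"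
  by (cases T) simp_all

text \<open>Inorder labels form four consecutive blocks: blue subtree, root, green subtree, red
  subtree. The offsets in the last two cases turn a label of the whole tree into a label of the
  subtree, which is the form that inductions over trees use.\<close>

lemma node_cases [consumes 1, case_names blue root green red]:
  assumes "x < num_nodes (Node b g r)"
  obtains "x < num_nodes b"
  | "x = num_nodes b"
  | y where "y < num_nodes g" "x = Suc (num_nodes b + y)"
  | y where "y < num_nodes r" "x = Suc (num_nodes b + num_nodes g + y)"
proof -
  consider "x < num_nodes b" | "x = num_nodes b"
    | "num_nodes b < x" "x \<le> num_nodes b + num_nodes g" | "num_nodes b + num_nodes g < x"
    by linarith
  then show thesis
  proof cases
    case 3
    then show thesis using that(3)[of "x - Suc (num_nodes b)"] by simp
  next
    case 4
    then show thesis
      using that(4)[of "x - Suc (num_nodes b + num_nodes g)"] assms by simp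
  qed (use that in auto)
qed

lemma inorder_nth [simp]:
  "x < num_nodes b \<Longrightarrow> inorder (Node b g r) ! x = Blue # inorder b ! x"
  "inorder (Node b g r) ! num_nodes b = []"
  "x < num_nodes g \<Longrightarrow> inorder (Node b g r) ! Suc (num_nodes b + x) = Green # inorder g ! x"
  "x < num_nodes r \<Longrightarrow>
    inorder (Node b g r) ! Suc (num_nodes b + num_nodes g + x) = Red # inorder r ! x"
  by (simp_all add: num_nodes_def nth_append)

declare inorder.simps(2) [simp del]

text \<open>Addresses inside a subtree begin with its color, so only the root has the empty address.
  Applied to a subtree, this shows that the child end of a branch leaving the root is the root of
  that subtree.\<close>

lemma inorder_nth_eq_Nil_iff:
  assumes "x < num_nodes T"
  shows "inorder T ! x = [] \<longleftrightarrow> x = root T"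
proof (cases T)
  case Empty
  then show ?thesis using assms by simp
next
  case (Node b g r)
  from assms[unfolded Node] show ?thesis
    unfolding Node by (cases rule: node_cases) auto
qed

lemma branch_less: "branch T x c y \<Longrightarrow> x < num_nodes T" "branch T x c y \<Longrightarrow> y < num_nodes T"
  by (simp_all add: branch_def)

lemma branch_blueI: "branch b x c y \<Longrightarrow> branch (Node b g r) x c y"
  by (simp add: branch_def)

lemma branch_greenI:
  "branch g x c y \<Longrightarrow> branch (Node b g r) (Suc (num_nodes b + x)) c (Suc (num_nodes b + y))"
  by (simp add: branch_def)

lemma branch_redI:
  "branch r x c y \<Longrightarrow>
    branch (Node b g r) (Suc (num_nodes b + num_nodes g + x)) c (Suc (num_nodes b + num_nodes g + y))"
  by (simp add: branch_def)

lemma branch_rootI: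
  "b \<noteq> Empty \<Longrightarrow> branch (Node b g r) (num_nodes b) Blue (root b)"
  "g \<noteq> Empty \<Longrightarrow> branch (Node b g r) (num_nodes b) Green (Suc (num_nodes b + root g))"
  "r \<noteq> Empty \<Longrightarrow>
    branch (Node b g r) (num_nodes b) Red (Suc (num_nodes b + num_nodes g + root r))"
  using root_less[of b] root_less[of g] root_less[of r]
  by (simp_all add: branch_def inorder_nth_eq_Nil_iff)

lemma not_branch_Empty [simp]: "\<not> branch Empty x c y"
  by (simp add: branch_def)

text \<open>A branch appends one color at the end of an address and so keeps the first color of a
  nonempty address. Hence it stays inside one subtree unless it starts at the root.\<close>

lemma branch_cases [consumes 1, case_names blue green red root_blue root_green root_red]:
  assumes "branch (Node b g r) x c y"
  obtains "branch b x c y"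
  | x' y' where "branch g x' c y'" "x = Suc (num_nodes b + x')" "y = Suc (num_nodes b + y')"
  | x' y' where "branch r x' c y'" "x = Suc (num_nodes b + num_nodes g + x')"
      "y = Suc (num_nodes b + num_nodes g + y')"
  | "b \<noteq> Empty" "c = Blue" "x = num_nodes b" "y = root b"
  | "g \<noteq> Empty" "c = Green" "x = num_nodes b" "y = Suc (num_nodes b + root g)"
  | "r \<noteq> Empty" "c = Red" "x = num_nodes b" "y = Suc (num_nodes b + num_nodes g + root r)"
proof -
  from assms have xy: "x < num_nodes (Node b g r)" "y < num_nodes (Node b g r)"
    and eq: "inorder (Node b g r) ! y = inorder (Node b g r) ! x @ [c]"
    by (simp_all only: branch_def)
  note [simp] = inorder_nth_eq_Nil_iff
  from xy(1) show thesis
  proof (cases rule: node_cases)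
    case blue
    from xy(2) show thesis
      by (cases rule: node_cases) (use blue eq that(1) in \<open>auto simp: branch_def\<close>)
  next
    case root
    from xy(2) show thesis
      by (cases rule: node_cases)
        (use root eq that(4-6) in \<open>auto dest: less_num_nodes_imp_nonempty\<close>)
  next
    case (green x')
    from xy(2) show thesis
      by (cases rule: node_cases) (use green eq that(2) in \<open>auto simp: branch_def\<close>)
  next
    case (red x')
    from xy(2) show thesis
      by (cases rule: node_cases) (use red eq that(3) in \<open>auto simp: branch_def\<close>)
  qed
qed

section \<open>The maximum functions of a tree\<close>

text \<open>Recursive counterpart of \<open>tree_max\<close>. The root needs no case distinction:
  without a green child \<open>num_nodes g\<close> is 0 and the root is its own image. The value on
  \<open>Empty\<close> is a default.\<close>

primrec gmax :: "tricolored_tree \<Rightarrow> nat \<Rightarrow> nat" where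
  "gmax Empty x = x"
| "gmax (Node b g r) x =
    (if x < num_nodes b then gmax b x
     else if x = num_nodes b then num_nodes b + num_nodes g
     else if x \<le> num_nodes b + num_nodes g
       then Suc (num_nodes b + gmax g (x - Suc (num_nodes b)))
     else Suc (num_nodes b + num_nodes g + gmax r (x - Suc (num_nodes b + num_nodes g))))"

text \<open>A node in the green subtree lies in the component of the root without blue branches iff it
  is connected to the last node of the green subtree.\<close>

primrec cmax :: "tricolored_tree \<Rightarrow> nat \<Rightarrow> nat" where
  "cmax Empty x = x"
| "cmax (Node b g r) x =
    (if x < num_nodes b then cmax b x
     else if x = num_nodes b then num_nodes b + num_nodes g + num_nodes r
     else if x \<le> num_nodes b + num_nodes g then
       let y = cmax g (x - Suc (num_nodes b))
       in if Suc y = num_nodes g then num_nodes b + num_nodes g + num_nodes r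
          else Suc (num_nodes b + y)
     else Suc (num_nodes b + num_nodes g + cmax r (x - Suc (num_nodes b + num_nodes g))))"

text \<open>The largest descendant.\<close>

primrec dmax :: "tricolored_tree \<Rightarrow> nat \<Rightarrow> nat" where
  "dmax Empty x = x"
| "dmax (Node b g r) x =
    (if x < num_nodes b then dmax b x
     else if x = num_nodes b then num_nodes b + num_nodes g + num_nodes r
     else if x \<le> num_nodes b + num_nodes g
       then Suc (num_nodes b + dmax g (x - Suc (num_nodes b)))
     else Suc (num_nodes b + num_nodes g + dmax r (x - Suc (num_nodes b + num_nodes g))))"

lemma gmax_Node [simp]:
  "x < num_nodes b \<Longrightarrow> gmax (Node b g r) x = gmax b x"
  "gmax (Node b g r) (num_nodes b) = num_nodes b + num_nodes g"
  "x < num_nodes g \<Longrightarrow> gmax (Node b g r) (Suc (num_nodes b + x)) = Suc (num_nodes b + gmax g x)"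
  "gmax (Node b g r) (Suc (num_nodes b + num_nodes g + x)) =
    Suc (num_nodes b + num_nodes g + gmax r x)"
  by simp_all

lemma cmax_Node [simp]:
  "x < num_nodes b \<Longrightarrow> cmax (Node b g r) x = cmax b x"
  "cmax (Node b g r) (num_nodes b) = num_nodes b + num_nodes g + num_nodes r"
  "x < num_nodes g \<Longrightarrow> cmax (Node b g r) (Suc (num_nodes b + x)) =
    (if Suc (cmax g x) = num_nodes g then num_nodes b + num_nodes g + num_nodes r
     else Suc (num_nodes b + cmax g x))"
  "cmax (Node b g r) (Suc (num_nodes b + num_nodes g + x)) =
    Suc (num_nodes b + num_nodes g + cmax r x)"
  by (simp_all add: Let_def)

lemma dmax_Node [simp]:
  "x < num_nodes b \<Longrightarrow> dmax (Node b g r) x = dmax b x"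
  "dmax (Node b g r) (num_nodes b) = num_nodes b + num_nodes g + num_nodes r"
  "x < num_nodes g \<Longrightarrow> dmax (Node b g r) (Suc (num_nodes b + x)) = Suc (num_nodes b + dmax g x)"
  "dmax (Node b g r) (Suc (num_nodes b + num_nodes g + x)) =
    Suc (num_nodes b + num_nodes g + dmax r x)"
  by simp_all

declare gmax.simps(2) [simp del] cmax.simps(2) [simp del] dmax.simps(2) [simp del]

section \<open>Largest descendants and the function \<open>gmax\<close>\<close>

lemma le_dmax: "x < num_nodes T \<Longrightarrow> x \<le> dmax T x \<and> dmax T x < num_nodes T"
proof (induction T arbitrary: x)
  case (Node b g r)
  from Node.prems show ?case
    by (cases rule: node_cases) (use Node.IH in \<open>fastforce\<close>)+
qed simp

lemma dmax_root: "T \<noteq> Empty \<Longrightarrow> Suc (dmax T (root T)) = num_nodes T"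
  by (cases T) simp_all

text \<open>The step of the upper bound for descendants: since \<open>dmax\<close> does not grow
  along branches, every descendant \<open>y\<close> of a node \<open>x\<close> satisfies
  \<open>y \<le> dmax T y \<le> dmax T x\<close>.\<close>

lemma dmax_branch: "branch T x c y \<Longrightarrow> dmax T y \<le> dmax T x"
proof (induction T arbitrary: x y)
  case (Node b g r)
  note le = le_dmax[OF root_less]
  from Node.prems show ?case
  proof (cases rule: branch_cases)
    case root_blue
    then show ?thesis using le[of b] root_less[of b] by simp
  next
    case root_green
    then show ?thesis using le[of g] root_less[of g] by simp
  next
    case root_red
    then show ?thesis using le[of r] root_less[of r] by simp
  qed (auto simp: Node.IH branch_less)
qed simp

lemma descendant_imp_dmax_le: "descendant T x y \<Longrightarrow> dmax T y \<le> dmax T x"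
  unfolding descendant_def
  by (induction rule: rtranclp_induct) (auto dest: dmax_branch)

lemma rtranclp_map_mono:
  assumes "R\<^sup>*\<^sup>* x y" "\<And>x y. R x y \<Longrightarrow> S (f x) (f y)"
  shows "S\<^sup>*\<^sup>* (f x) (f y)"
  using assms(1) by induction (auto intro: rtranclp.rtrancl_into_rtrancl dest: assms(2))

lemma descendant_blueI: "descendant b x y \<Longrightarrow> descendant (Node b g r) x y"
  unfolding descendant_def by (erule rtranclp_map_mono[where f = "\<lambda>x. x"]) (auto dest: branch_blueI)

lemma descendant_greenI:
  "descendant g x y \<Longrightarrow>
    descendant (Node b g r) (Suc (num_nodes b + x)) (Suc (num_nodes b + y))"
  unfolding descendant_def by (erule rtranclp_map_mono) (blast intro: branch_greenI)

lemma descendant_redI: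
  "descendant r x y \<Longrightarrow>
    descendant (Node b g r)
      (Suc (num_nodes b + num_nodes g + x)) (Suc (num_nodes b + num_nodes g + y))"
  unfolding descendant_def by (erule rtranclp_map_mono) (blast intro: branch_redI)

lemma descendant_refl [simp]: "descendant T x x"
  by (simp add: descendant_def)

lemma descendant_branch: "branch T x c y \<Longrightarrow> descendant T y z \<Longrightarrow> descendant T x z"
  unfolding descendant_def by (blast intro: converse_rtranclp_into_rtranclp)

lemma descendant_root: "x < num_nodes T \<Longrightarrow> descendant T (root T) x"
proof (induction T arbitrary: x)
  case (Node b g r)
  from Node.prems show ?case
  proof (cases rule: node_cases)
    case blue
    then have "b \<noteq> Empty" by auto
    then show ?thesis
      using descendant_branch[OF branch_rootI(1) descendant_blueI[OF Node.IH(1)[OF blue]]] by simp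
  next
    case (green y)
    then have "g \<noteq> Empty" by auto
    then show ?thesis
      using descendant_branch[OF branch_rootI(2) descendant_greenI[OF Node.IH(2)[OF green(1)]]] green(2)
      by simp
  next
    case (red y)
    then have "r \<noteq> Empty" by auto
    then show ?thesis
      using descendant_branch[OF branch_rootI(3) descendant_redI[OF Node.IH(3)[OF red(1)]]] red(2)
      by simp
  qed simp
qed simp

text \<open>The upper bound is attained. The only case not inherited from a subtree is the root,
  from which every node, in particular the last one, is reached.\<close>

lemma descendant_dmax: "x < num_nodes T \<Longrightarrow> descendant T x (dmax T x)"
proof (induction T arbitrary: x)
  case (Node b g r)
  from Node.prems show ?case
  proof (cases rule: node_cases)
    case root
    have "descendant (Node b g r) (root (Node b g r)) (num_nodes b + num_nodes g + num_nodes r)"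
      by (rule descendant_root) simp
    then show ?thesis using root by simp
  qed (use Node.IH in \<open>auto intro: descendant_blueI descendant_greenI descendant_redI\<close>)
qed simp

text \<open>For the green branch at the root both sides are the last node of the green subtree; all
  other green branches lie inside subtrees.\<close>

lemma gmax_branch_Green: "branch T x Green y \<Longrightarrow> gmax T x = dmax T y"
proof (induction T arbitrary: x y)
  case (Node b g r)
  from Node.prems show ?case
  proof (cases rule: branch_cases)
    case root_green
    then show ?thesis using dmax_root[of g] root_less[of g] by simp
  qed (auto simp: Node.IH branch_less)
qed simp

lemma gmax_no_branch_Green: "x < num_nodes T \<Longrightarrow> \<nexists>y. branch T x Green y \<Longrightarrow> gmax T x = x"
proof (induction T arbitrary: x)
  case (Node b g r)
  from Node.prems(1) show ?case
  proof (cases rule: node_cases)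
    case blue
    then show ?thesis using Node.IH(1)[OF blue] Node.prems(2) by (auto dest: branch_blueI)
  next
    case root
    then show ?thesis using Node.prems(2) branch_rootI(2)[of g b r] by fastforce
  next
    case (green y)
    then show ?thesis using Node.IH(2)[OF green(1)] Node.prems(2) by (auto dest: branch_greenI)
  next
    case (red y)
    then show ?thesis using Node.IH(3)[OF red(1)] Node.prems(2) by (auto dest: branch_redI)
  qed
qed simp

lemma descendant_less: "descendant T x y \<Longrightarrow> x < num_nodes T \<Longrightarrow> y < num_nodes T"
  unfolding descendant_def by (induction rule: rtranclp_induct) (auto dest: branch_less)

text \<open>Ensures that the maximum in \<open>tree_max\<close> ranges over the descendants of a
  single green child.\<close>

lemma branch_unique: "branch T x c y \<Longrightarrow> branch T x c z \<Longrightarrow> y = z"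
proof (induction T arbitrary: x y z)
  case (Node b g r)
  from Node.prems(1) show ?case
    by (cases rule: branch_cases; use Node.prems(2) in \<open>cases rule: branch_cases\<close>)
      (auto dest: Node.IH branch_less)
qed simp

lemma tree_max_eq_gmax:
  assumes "x < num_nodes T"
  shows "tree_max T x = gmax T x"
proof (cases "\<exists>y. branch T x Green y")
  case True
  then obtain y where y: "branch T x Green y" by blast
  have eq: "{z. \<exists>y. branch T x Green y \<and> descendant T y z} = {z. descendant T y z}"
    using y branch_unique by blast
  have "Max {z. descendant T y z} = dmax T y"
  proof (rule Max_eqI)
    have "{z. descendant T y z} \<subseteq> {..<num_nodes T}"
      using descendant_less branch_less(2)[OF y] by blast
    then show "finite {z. descendant T y z}"
      by (rule finite_subset) simp
    show "z \<le> dmax T y" if "z \<in> {z. descendant T y z}" for z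
      using that descendant_imp_dmax_le[of T y z] le_dmax[of z T]
        descendant_less branch_less(2)[OF y] by fastforce
    show "dmax T y \<in> {z. descendant T y z}"
      using descendant_dmax branch_less(2)[OF y] by blast
  qed
  then show ?thesis
    using True eq gmax_branch_Green[OF y] by (simp add: tree_max_def)
next
  case False
  then show ?thesis
    using gmax_no_branch_Green[OF assms] by (simp add: tree_max_def)
qed

section \<open>Components without blue branches and the function \<open>cmax\<close>\<close>

lemma cmax_root: "T \<noteq> Empty \<Longrightarrow> Suc (cmax T (root T)) = num_nodes T"
  by (cases T) simp_all

lemma le_cmax: "x < num_nodes T \<Longrightarrow> x \<le> cmax T x \<and> cmax T x < num_nodes T"
proof (induction T arbitrary: x)
  case (Node b g r)
  from Node.prems show ?case
    by (cases rule: node_cases) (use Node.IH in \<open>fastforce simp: Let_def\<close>)+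
qed simp

text \<open>Makes \<open>cmax\<close> an invariant of the components. A green or red branch at the
  root ends in the root of a subtree, whose value there is the last node of that subtree; in the
  green case this is redirected to the last node of the tree, in the red case it already is that
  node.\<close>

lemma cmax_branch: "branch T x c y \<Longrightarrow> c \<noteq> Blue \<Longrightarrow> cmax T x = cmax T y"
proof (induction T arbitrary: x y)
  case (Node b g r)
  from Node.prems(1) show ?case
  proof (cases rule: branch_cases)
    case root_green
    then show ?thesis using cmax_root[of g] root_less[of g] by simp
  next
    case root_red
    then show ?thesis using cmax_root[of r] root_less[of r] by simp
  qed (use Node.prems(2) in \<open>auto simp: Node.IH branch_less\<close>)
qed simp

lemma equivclp_map_mono:
  assumes "equivclp R x y" "\<And>x y. R x y \<Longrightarrow> S (f x) (f y)"
  shows "equivclp S (f x) (f y)"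
  using assms(1)
proof (induction rule: equivclp_induct)
  case (step y z)
  then have "equivclp S (f y) (f z)"
    using assms(2) by (metis r_into_equivclp equivclp_sym)
  with step.IH show ?case by (rule equivclp_trans)
qed simp

lemma red_green_connected_blueI:
  "red_green_connected b x y \<Longrightarrow> red_green_connected (Node b g r) x y"
  unfolding red_green_connected_def
  by (erule equivclp_map_mono[where f = "\<lambda>x. x"]) (blast intro: branch_blueI)

lemma red_green_connected_greenI:
  "red_green_connected g x y \<Longrightarrow>
    red_green_connected (Node b g r) (Suc (num_nodes b + x)) (Suc (num_nodes b + y))"
  unfolding red_green_connected_def
  by (erule equivclp_map_mono) (blast intro: branch_greenI)

lemma red_green_connected_redI:
  "red_green_connected r x y \<Longrightarrow>
    red_green_connected (Node b g r)
      (Suc (num_nodes b + num_nodes g + x)) (Suc (num_nodes b + num_nodes g + y))"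
  unfolding red_green_connected_def
  by (erule equivclp_map_mono) (blast intro: branch_redI)

lemma red_green_connected_refl [simp]: "red_green_connected T x x"
  by (simp add: red_green_connected_def)

lemma red_green_connected_sym: "red_green_connected T x y \<Longrightarrow> red_green_connected T y x"
  unfolding red_green_connected_def by (rule equivclp_sym)

lemma red_green_connected_trans:
  "red_green_connected T x y \<Longrightarrow> red_green_connected T y z \<Longrightarrow> red_green_connected T x z"
  unfolding red_green_connected_def by (rule equivclp_trans)

lemma branch_imp_red_green_connected:
  "branch T x c y \<Longrightarrow> c \<noteq> Blue \<Longrightarrow> red_green_connected T x y"
  unfolding red_green_connected_def by (cases c) auto

text \<open>The last node is reached by going to the red child as long as there is one, and
  otherwise to the green child.\<close>

lemma red_green_connected_root_last:
  "T \<noteq> Empty \<Longrightarrow> red_green_connected T (root T) (num_nodes T - 1)"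
proof (induction T)
  case (Node b g r)
  let ?T = "Node b g r"
  consider "r \<noteq> Empty" | "r = Empty" "g \<noteq> Empty" | "r = Empty" "g = Empty"
    by blast
  then show ?case
  proof cases
    case 1
    then show ?thesis
      using red_green_connected_trans[OF branch_imp_red_green_connected[OF branch_rootI(3)]
          red_green_connected_redI[OF Node.IH(3)], of b g] num_nodes_eq_0_iff[of r]
      by (simp del: num_nodes_eq_0_iff)
  next
    case 2
    then show ?thesis
      using red_green_connected_trans[OF branch_imp_red_green_connected[OF branch_rootI(2)]
          red_green_connected_greenI[OF Node.IH(2)], of b r] num_nodes_eq_0_iff[of g]
      by (simp del: num_nodes_eq_0_iff)
  qed simp
qed simp

lemma red_green_connected_cmax: "x < num_nodes T \<Longrightarrow> red_green_connected T x (cmax T x)"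
proof (induction T arbitrary: x)
  case (Node b g r)
  have last: "red_green_connected (Node b g r) (num_nodes b) (num_nodes b + num_nodes g + num_nodes r)"
    using red_green_connected_root_last[of "Node b g r"] by simp
  from Node.prems show ?case
  proof (cases rule: node_cases)
    case blue
    then show ?thesis using Node.IH(1) by (auto intro: red_green_connected_blueI)
  next
    case root
    then show ?thesis using last by simp
  next
    case (green y)
    then have g: "g \<noteq> Empty" by auto
    have conn: "red_green_connected (Node b g r) x (Suc (num_nodes b + cmax g y))"
      using Node.IH(2)[OF green(1)] green(2) by (simp add: red_green_connected_greenI)
    show ?thesis
    proof (cases "Suc (cmax g y) = num_nodes g")
      case True
      \<comment> \<open>The component of \<open>y\<close> in \<open>g\<close> contains the last node
        of \<open>g\<close>, hence also the root of \<open>g\<close>. The green branch above it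
        leads on to the root of the tree, and from there \<open>last\<close> applies.\<close>
      have "red_green_connected (Node b g r) (Suc (num_nodes b + root g)) (Suc (num_nodes b + cmax g y))"
        using red_green_connected_root_last[OF g] True
        by (metis diff_Suc_1 red_green_connected_greenI)
      with conn last branch_imp_red_green_connected[OF branch_rootI(2)[OF g], of b r]
      have "red_green_connected (Node b g r) x (num_nodes b + num_nodes g + num_nodes r)"
        by (meson color.distinct red_green_connected_sym red_green_connected_trans)
      then show ?thesis using True green by simp
    next
      case False
      then show ?thesis using conn green by simp
    qed
  next
    case (red y)
    then show ?thesis using Node.IH(3) by (auto intro: red_green_connected_redI)
  qed
qed simp

lemma red_green_connected_imp_cmax_eq: "red_green_connected T x y \<Longrightarrow> cmax T x = cmax T y"
  unfolding red_green_connected_def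
  by (induction rule: equivclp_induct) (auto dest: cmax_branch)

lemma red_green_connected_less:
  "red_green_connected T x y \<Longrightarrow> x < num_nodes T \<Longrightarrow> y < num_nodes T"
  unfolding red_green_connected_def
  by (induction rule: equivclp_induct) (auto dest: branch_less)

lemma tree_max'_eq_cmax:
  assumes "x < num_nodes T"
  shows "tree_max' T x = cmax T x"
  unfolding tree_max'_def
proof (rule Max_eqI)
  have less: "y < num_nodes T" if "red_green_connected T y x" for y
    using that assms red_green_connected_less red_green_connected_sym by blast
  then have "{y. red_green_connected T y x} \<subseteq> {..<num_nodes T}"
    by blast
  then show "finite {y. red_green_connected T y x}"
    by (rule finite_subset) simp
  show "y \<le> cmax T x" if "y \<in> {y. red_green_connected T y x}" for y
    using that less le_cmax red_green_connected_imp_cmax_eq by fastforce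
  show "cmax T x \<in> {y. red_green_connected T y x}"
    using red_green_connected_cmax[OF assms] by (simp add: red_green_connected_sym)
qed

section \<open>Red branches below non-red ones\<close>

primrec red_free :: "tricolored_tree \<Rightarrow> bool" where
  "red_free Empty \<longleftrightarrow> True"
| "red_free (Node b g r) \<longleftrightarrow> red_free b \<and> red_free g \<and> r = Empty"

text \<open>Red branches occur only on the chain of red branches that starts at the root. This is
  the recursive form of the condition in the second half of the theorem.\<close>

primrec red_at_top :: "tricolored_tree \<Rightarrow> bool" where
  "red_at_top Empty \<longleftrightarrow> True"
| "red_at_top (Node b g r) \<longleftrightarrow> red_free b \<and> red_free g \<and> red_at_top r"

lemma red_free_iff: "red_free T \<longleftrightarrow> \<not> (\<exists>x y. branch T x Red y)"
proof (induction T)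
  case (Node b g r)
  have "(\<exists>x y. branch (Node b g r) x Red y) \<longleftrightarrow>
      (\<exists>x y. branch b x Red y) \<or> (\<exists>x y. branch g x Red y) \<or> r \<noteq> Empty"
    (is "?L \<longleftrightarrow> ?R")
  proof
    assume ?L
    then obtain x y where "branch (Node b g r) x Red y" by blast
    then show ?R by (cases rule: branch_cases) auto
  next
    assume ?R
    then show ?L using branch_blueI branch_greenI branch_rootI(3) by blast
  qed
  with Node.IH show ?case by simp
qed simp

lemma descendant_blueD:
  assumes "descendant (Node b g r) x y" "x < num_nodes b"
  shows "y < num_nodes b \<and> descendant b x y"
  using assms(1) unfolding descendant_def
proof (induction rule: rtranclp_induct)
  case (step y z)
  then obtain c where "branch (Node b g r) y c z" by blast
  then show ?case
    by (cases rule: branch_cases)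
      (use step.IH in \<open>auto dest: branch_less intro: rtranclp.rtrancl_into_rtrancl\<close>)
qed (use assms(2) in simp)

lemma descendant_greenD:
  assumes "descendant (Node b g r) (Suc (num_nodes b + x)) y" "x < num_nodes g"
  shows "\<exists>y'. y = Suc (num_nodes b + y') \<and> y' < num_nodes g \<and> descendant g x y'"
  using assms(1) unfolding descendant_def
proof (induction rule: rtranclp_induct)
  case (step y z)
  then obtain c where "branch (Node b g r) y c z" by blast
  then show ?case
    by (cases rule: branch_cases)
      (use step.IH in \<open>auto dest: branch_less intro: rtranclp.rtrancl_into_rtrancl\<close>)
qed (use assms(2) in simp)

lemma descendant_redD:
  assumes "descendant (Node b g r) (Suc (num_nodes b + num_nodes g + x)) y" "x < num_nodes r"
  shows "\<exists>y'. y = Suc (num_nodes b + num_nodes g + y') \<and> y' < num_nodes r \<and> descendant r x y'"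
  using assms(1) unfolding descendant_def
proof (induction rule: rtranclp_induct)
  case (step y z)
  then obtain c where "branch (Node b g r) y c z" by blast
  then show ?case
    by (cases rule: branch_cases)
      (use step.IH in \<open>auto dest: branch_less intro: rtranclp.rtrancl_into_rtrancl\<close>)
qed (use assms(2) in simp)

lemma branch_blueD: "branch (Node b g r) x c y \<Longrightarrow> x < num_nodes b \<Longrightarrow> branch b x c y"
  by (erule branch_cases) auto

lemma branch_greenD:
  "branch (Node b g r) (Suc (num_nodes b + x)) c y \<Longrightarrow> x < num_nodes g \<Longrightarrow> \<exists>y'. branch g x c y'"
  by (erule branch_cases) (auto dest: branch_less)

lemma branch_redD:
  "branch (Node b g r) (Suc (num_nodes b + num_nodes g + x)) c y \<Longrightarrow> \<exists>y'. branch r x c y'"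
  by (erule branch_cases) (auto dest: branch_less)

text \<open>A red branch inside the blue or green subtree is descended from the branch that joins
  the root to this subtree. If the non-red branch lies in the red subtree, so does every red branch
  descended from it. The red branch at the root is descended from nothing.\<close>

lemma has_red_descended_from_nonred_Node:
  "has_red_descended_from_nonred (Node b g r) \<longleftrightarrow>
    \<not> red_free b \<or> \<not> red_free g \<or> has_red_descended_from_nonred r" (is "?L \<longleftrightarrow> ?R")
proof
  assume ?L
  then obtain x y u v c where xy: "branch (Node b g r) x Red y"
    and uv: "branch (Node b g r) u c v" "c \<noteq> Red" and vx: "descendant (Node b g r) v x"
    unfolding has_red_descended_from_nonred_def by blast
  \<comment> \<open>Phrased by the position of \<open>v\<close>, so that it covers both a branch
    inside the blue subtree and the branch from the root into it; likewise for green in the next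
    fact.\<close>
  have b: ?R if "v < num_nodes b"
    using that descendant_blueD[OF vx] branch_blueD[OF xy] by (auto simp: red_free_iff)
  have g: ?R if "v = Suc (num_nodes b + v')" "v' < num_nodes g" for v'
  proof -
    note v = that
    obtain x' where x': "x = Suc (num_nodes b + x')" "x' < num_nodes g"
      using descendant_greenD[OF vx[unfolded v(1)] v(2)] by blast
    then show ?thesis
      using branch_greenD[OF xy[unfolded x'(1)]] by (auto simp: red_free_iff)
  qed
  from uv(1) show ?R
  proof (cases rule: branch_cases)
    case blue
    then show ?thesis using b branch_less by blast
  next
    case green
    then show ?thesis using g branch_less by blast
  next
    case (red u' v')
    obtain x' where x': "x = Suc (num_nodes b + num_nodes g + x')" "descendant r v' x'"
      using descendant_redD[OF vx[unfolded red(3)] branch_less(2)[OF red(1)]] by blast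
    moreover obtain y' where "branch r x' Red y'"
      using branch_redD[OF xy[unfolded x'(1)]] by blast
    ultimately show ?thesis
      using red(1) uv(2) unfolding has_red_descended_from_nonred_def by blast
  next
    case root_blue
    then show ?thesis using b root_less by blast
  next
    case root_green
    then show ?thesis using g root_less by blast
  next
    case root_red
    then show ?thesis using uv(2) by simp
  qed
next
  assume ?R
  then consider x y where "branch b x Red y" | x y where "branch g x Red y"
    | "has_red_descended_from_nonred r"
    by (auto simp: red_free_iff)
  then show ?L
  proof cases
    case 1
    then have "b \<noteq> Empty" "descendant b (root b) x"
      using descendant_root branch_less(1) by auto
    then show ?thesis
      unfolding has_red_descended_from_nonred_def
      using branch_blueI[OF 1, of g r] branch_rootI(1)[of b g r] descendant_blueI[of b "root b" x g r]
      by blast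
  next
    case 2
    then have "g \<noteq> Empty" "descendant g (root g) x"
      using descendant_root branch_less(1) by auto
    then show ?thesis
      unfolding has_red_descended_from_nonred_def
      using branch_greenI[OF 2, of b r] branch_rootI(2)[of g b r]
        descendant_greenI[of g "root g" x b r]
      by blast
  next
    case 3
    then obtain x y u v c where "branch r x Red y" "branch r u c v" "c \<noteq> Red" "descendant r v x"
      unfolding has_red_descended_from_nonred_def by blast
    then show ?thesis
      unfolding has_red_descended_from_nonred_def
      using branch_redI[of r _ _ _ b g] descendant_redI[of r v x b g] by blast
  qed
qed

lemma has_red_descended_from_nonred_iff: "has_red_descended_from_nonred T \<longleftrightarrow> \<not> red_at_top T"
  by (induction T)
    (simp_all add: has_red_descended_from_nonred_Node, simp add: has_red_descended_from_nonred_def)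

section \<open>Kreweras pairs as pairs of functions\<close>

text \<open>The functions that arise as \<open>transfer_max R\<close>: any two of the intervals
  \<open>{i..p i}\<close> are nested or disjoint. Here \<open>N\<close> counts the elements, so
  \<open>[n]\<close> corresponds to \<open>N = Suc n\<close>.\<close>

definition noncrossing :: "nat \<Rightarrow> (nat \<Rightarrow> nat) \<Rightarrow> bool" where
  "noncrossing N p \<longleftrightarrow>
    (\<forall>i<N. i \<le> p i \<and> p i < N \<and> (\<forall>j. i \<le> j \<longrightarrow> j \<le> p i \<longrightarrow> p j \<le> p i))"

definition kreweras :: "nat \<Rightarrow> (nat \<Rightarrow> nat) \<Rightarrow> (nat \<Rightarrow> nat) \<Rightarrow> bool" where
  "kreweras N p p' \<longleftrightarrow> noncrossing N p \<and> noncrossing N p' \<and>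
    (\<forall>i<N. \<forall>j<N. p i = p j \<longrightarrow> p' i = p' j)"

lemma noncrossingD:
  assumes "noncrossing N p" "i < N"
  shows "i \<le> p i" "p i < N" "i \<le> j \<Longrightarrow> j \<le> p i \<Longrightarrow> p j \<le> p i"
  using assms by (auto simp: noncrossing_def)

lemma noncrossing_idem: "noncrossing N p \<Longrightarrow> i < N \<Longrightarrow> p (p i) = p i"
  by (simp add: le_antisym noncrossingD)

text \<open>The point \<open>p i\<close> has the same image as \<open>i\<close> under
  \<open>p\<close>, hence also under \<open>p'\<close>. Thus
  \<open>p' i = p' (p i) \<ge> p i\<close>.\<close>

lemma kreweras_le:
  assumes "kreweras N p p'" "i < N"
  shows "p i \<le> p' i"
proof -
  have nc: "noncrossing N p" "noncrossing N p'"
    using assms(1) by (simp_all add: kreweras_def)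
  then have pi: "p i < N" "p (p i) = p i"
    using assms(2) by (simp_all add: noncrossingD noncrossing_idem)
  then have "p' (p i) = p' i"
    using assms unfolding kreweras_def by blast
  then show ?thesis
    using noncrossingD(1)[OF nc(2) pi(1)] by simp
qed

section \<open>Transfer systems correspond to noncrossing functions\<close>

lemma transfer_max_rel_of_max:
  assumes "i \<le> n" "i \<le> p i"
  shows "transfer_max (rel_of_max n p) i = p i"
proof -
  have "{j. (i, j) \<in> rel_of_max n p} = {i..p i}"
    using assms(1) by (auto simp: rel_of_max_def)
  then show ?thesis
    unfolding transfer_max_def using assms(2) by (auto intro: Max_eqI)
qed

lemma transfer_system_rel_of_max:
  assumes "noncrossing (Suc n) p"
  shows "transfer_system n (rel_of_max n p)"
proof -
  note p = noncrossingD[OF assms, unfolded less_Suc_eq_le]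
  have "rel_of_max n p \<subseteq> {0..n} \<times> {0..n}"
  proof clarify
    fix i j assume "(i, j) \<in> rel_of_max n p"
    then show "i \<in> {0..n} \<and> j \<in> {0..n}"
      using p(2)[of i] by (simp add: rel_of_max_def)
  qed
  moreover have "refl_on {0..n} (rel_of_max n p)"
    using p(1) by (auto simp: rel_of_max_def refl_on_def)
  moreover have "trans (rel_of_max n p)"
  proof (rule transI)
    fix x y z assume "(x, y) \<in> rel_of_max n p" "(y, z) \<in> rel_of_max n p"
    then show "(x, z) \<in> rel_of_max n p"
      using p(3)[of x y] by (auto simp: rel_of_max_def)
  qed
  moreover have "antisym (rel_of_max n p)"
    by (auto simp: rel_of_max_def antisym_def)
  moreover have "\<forall>x y. (x, y) \<in> rel_of_max n p \<longrightarrow> x \<le> y"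
    by (simp add: rel_of_max_def)
  moreover have "(min x z, z) \<in> rel_of_max n p" if "(x, y) \<in> rel_of_max n p" "z \<le> y" for x y z
    using that p(1)[of z] p(2)[of x] by (auto simp: rel_of_max_def min_def)
  ultimately show ?thesis
    unfolding transfer_system_def partial_order_on_def preorder_on_def by blast
qed

lemma transfer_system_max:
  assumes "transfer_system n R"
  shows "rel_of_max n (transfer_max R) = R" "noncrossing (Suc n) (transfer_max R)"
proof -
  have sub: "R \<subseteq> {0..n} \<times> {0..n}" and refl: "\<And>x. x \<le> n \<Longrightarrow> (x, x) \<in> R" and tr: "trans R"
    and le: "\<And>x y. (x, y) \<in> R \<Longrightarrow> x \<le> y"
    and res: "\<And>x y z. (x, y) \<in> R \<Longrightarrow> z \<le> y \<Longrightarrow> (min x z, z) \<in> R"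
    using assms
    by (auto simp: transfer_system_def partial_order_on_def preorder_on_def refl_on_def)
  have fin: "finite {j. (i, j) \<in> R}" for i
    by (rule finite_subset[of _ "{0..n}"]) (use sub in auto)
  have max_in: "(i, transfer_max R i) \<in> R" if "i \<le> n" for i
    unfolding transfer_max_def using Max_in[OF fin, of i] refl[OF that] by blast
  have max_ge: "j \<le> transfer_max R i" if "(i, j) \<in> R" for i j
    unfolding transfer_max_def using Max_ge[OF fin, of j i] that by blast
  \<comment> \<open>Restricting the longest relation out of \<open>i\<close> to a target
    \<open>j \<ge> i\<close> gives \<open>(i, j) \<in> R\<close>, because
    \<open>min i j = i\<close>. So the targets of \<open>i\<close> fill an interval.\<close>
  have iff: "(i, j) \<in> R \<longleftrightarrow> i \<le> n \<and> i \<le> j \<and> j \<le> transfer_max R i" for i j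
    using max_in[of i] max_ge[of i j] res[of i "transfer_max R i" j] le sub by (auto simp: min_def)
  show "rel_of_max n (transfer_max R) = R"
    by (auto simp: rel_of_max_def iff)
  show "noncrossing (Suc n) (transfer_max R)"
    unfolding noncrossing_def less_Suc_eq_le
  proof (intro allI impI conjI)
    fix i assume i: "i \<le> n"
    then show "i \<le> transfer_max R i" "transfer_max R i \<le> n"
      using max_in[OF i] sub le by auto
    fix j assume j: "i \<le> j" "j \<le> transfer_max R i"
    then have "(i, j) \<in> R" "j \<le> n"
      using i \<open>transfer_max R i \<le> n\<close> by (auto simp: iff)
    then show "transfer_max R j \<le> transfer_max R i"
      using max_in[of j] tr max_ge by (meson transD)
  qed
qed

lemma kreweras_imp_kreweras_pair:
  assumes "kreweras (Suc n) p p'"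
  shows "kreweras_pair n (rel_of_max n p) (rel_of_max n p')"
proof -
  have nc: "noncrossing (Suc n) p" "noncrossing (Suc n) p'"
    using assms by (simp_all add: kreweras_def)
  have eq: "p' i = p' j" if "i \<le> n" "j \<le> n" "p i = p j" for i j
    using that assms unfolding kreweras_def less_Suc_eq_le by blast
  have max: "transfer_max (rel_of_max n p) i = p i" "transfer_max (rel_of_max n p') i = p' i"
    if "i \<le> n" for i
    using that noncrossingD(1)[OF nc(1), of i] noncrossingD(1)[OF nc(2), of i]
    by (simp_all add: transfer_max_rel_of_max)
  show ?thesis
    unfolding kreweras_pair_def
  proof (intro conjI allI impI)
    fix i j
    assume "i \<le> n" "j \<le> n" "transfer_max (rel_of_max n p) i = transfer_max (rel_of_max n p) j"
    then show "transfer_max (rel_of_max n p') i = transfer_max (rel_of_max n p') j"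
      using eq[of i j] by (simp only: max)
  qed (use nc in \<open>simp_all add: transfer_system_rel_of_max\<close>)
qed

lemma kreweras_pair_imp_kreweras:
  assumes "kreweras_pair n R R'"
  shows "kreweras (Suc n) (transfer_max R) (transfer_max R')"
  using assms transfer_system_max(2)[of n R] transfer_system_max(2)[of n R']
  unfolding kreweras_pair_def kreweras_def less_Suc_eq_le by blast

section \<open>The bijection\<close>

text \<open>The interval of the root consists of the root and the whole green block; every other
  interval stays inside the block in which it starts.\<close>

lemma noncrossing_gmax: "noncrossing (num_nodes T) (gmax T)"
proof (induction T)
  case (Node b g r)
  note b = noncrossingD[OF Node.IH(1)] and g = noncrossingD[OF Node.IH(2)]
    and r = noncrossingD[OF Node.IH(3)]
  let ?T = "Node b g r"
  have "i \<le> gmax ?T i \<and> gmax ?T i < num_nodes ?T \<and>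
      (i \<le> j \<longrightarrow> j \<le> gmax ?T i \<longrightarrow> gmax ?T j \<le> gmax ?T i)"
    if "i < num_nodes ?T" for i j
    using that
  proof (cases rule: node_cases)
    case blue
    then show ?thesis using b(2)[OF blue] b(1)[OF blue] b(3)[OF blue, of j] by auto
  next
    case root
    have "gmax ?T j \<le> gmax ?T i" if ij: "i \<le> j" "j \<le> gmax ?T i"
    proof -
      have "j < num_nodes ?T" using ij(2) root by simp
      then show ?thesis
        by (cases rule: node_cases) (use root ij g(2) in \<open>auto simp: Suc_le_eq\<close>)
    qed
    then show ?thesis using root by simp
  next
    case (green y)
    have "gmax ?T j \<le> gmax ?T i" if ij: "i \<le> j" "j \<le> gmax ?T i"
    proof -
      obtain k where "j = i + k"
        using le_Suc_ex[OF ij(1)] by blast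
      then have j: "j = Suc (num_nodes b + (y + k))"
        using green by simp
      have "y + k \<le> gmax g y"
        using ij(2) green j by simp
      then show ?thesis
        using g(2)[OF green(1)] g(3)[OF green(1), of "y + k"] green j by simp
    qed
    then show ?thesis using g(1,2)[OF green(1)] green by simp
  next
    case (red y)
    have "gmax ?T j \<le> gmax ?T i" if ij: "i \<le> j" "j \<le> gmax ?T i"
    proof -
      obtain k where "j = i + k"
        using le_Suc_ex[OF ij(1)] by blast
      then have j: "j = Suc (num_nodes b + num_nodes g + (y + k))"
        using red by simp
      have "y + k \<le> gmax r y"
        using ij(2) red j by simp
      then show ?thesis
        using r(2)[OF red(1)] r(3)[OF red(1), of "y + k"] red j by simp
    qed
    then show ?thesis using r(1,2)[OF red(1)] red by simp
  qed
  then show ?case unfolding noncrossing_def by blast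
qed (simp add: noncrossing_def)

lemma noncrossing_cmax: "noncrossing (num_nodes T) (cmax T)"
proof (induction T)
  case (Node b g r)
  note b = noncrossingD[OF Node.IH(1)] and g = noncrossingD[OF Node.IH(2)]
    and r = noncrossingD[OF Node.IH(3)]
  let ?T = "Node b g r"
  have "i \<le> j \<longrightarrow> j \<le> cmax ?T i \<longrightarrow> cmax ?T j \<le> cmax ?T i"
    if i: "i < num_nodes ?T" for i j
  \<comment> \<open>An interval that ends at the last node cannot be crossed. Setting these aside
    removes the root and all redirected green values, which leaves intervals inside a single
    subtree.\<close>
  proof (cases "cmax ?T i = num_nodes b + num_nodes g + num_nodes r")
    case True
    then show ?thesis using le_cmax[of j ?T] le_cmax[OF i] by fastforce
  next
    case not_last: False
    from i show ?thesis
    proof (cases rule: node_cases)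
      case blue
      then show ?thesis using b(2)[OF blue] b(1)[OF blue] b(3)[OF blue, of j] by auto
    next
      case root
      then show ?thesis using not_last by simp
    next
      case (green y)
      then have y: "Suc (cmax g y) \<noteq> num_nodes g"
        using not_last by auto
      have "cmax ?T j \<le> cmax ?T i" if ij: "i \<le> j" "j \<le> cmax ?T i"
      proof -
        obtain k where "j = i + k"
          using le_Suc_ex[OF ij(1)] by blast
        then have j: "j = Suc (num_nodes b + (y + k))"
          using green by simp
        have "y + k \<le> cmax g y"
          using ij(2) green y j by simp
        then show ?thesis
          using g(2)[OF green(1)] g(3)[OF green(1), of "y + k"] green j y by simp
      qed
      then show ?thesis by simp
    next
      case (red y)
      have "cmax ?T j \<le> cmax ?T i" if ij: "i \<le> j" "j \<le> cmax ?T i"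
      proof -
        obtain k where "j = i + k"
          using le_Suc_ex[OF ij(1)] by blast
        then have j: "j = Suc (num_nodes b + num_nodes g + (y + k))"
          using red by simp
        have "y + k \<le> cmax r y"
          using ij(2) red j by simp
        then show ?thesis
          using r(2)[OF red(1)] r(3)[OF red(1), of "y + k"] red j by simp
      qed
      then show ?thesis by simp
    qed
  qed
  then show ?case unfolding noncrossing_def using le_cmax by blast
qed (simp add: noncrossing_def)

text \<open>Nodes of different blocks can share a \<open>gmax\<close> value only if one is the root
  and the other is a green node mapped to the last green node. Both then have the last node of the
  tree as their \<open>cmax\<close> value.\<close>

lemma kreweras_tree: "kreweras (num_nodes T) (gmax T) (cmax T)"
  unfolding kreweras_def
proof (intro conjI noncrossing_gmax noncrossing_cmax)
  show "\<forall>i<num_nodes T. \<forall>j<num_nodes T. gmax T i = gmax T j \<longrightarrow> cmax T i = cmax T j"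
  proof (induction T)
    case (Node b g r)
    let ?T = "Node b g r"
    note IH = Node.IH[rule_format]
    have wlog: "cmax ?T i = cmax ?T j"
      if "i \<le> j" "i < num_nodes ?T" and j: "j < num_nodes ?T" and eq: "gmax ?T i = gmax ?T j" for i j
      using that(2)
    proof (cases rule: node_cases)
      case blue
      then have "gmax ?T j < num_nodes b"
        using eq noncrossingD(2)[OF noncrossing_gmax blue] by simp
      then have "j < num_nodes b"
        using noncrossingD(1)[OF noncrossing_gmax j] by linarith
      then show ?thesis using blue eq IH(1)[of i j] by simp
    next
      case root
      from j show ?thesis
      proof (cases rule: node_cases)
        case (green y)
        then have "Suc (gmax g y) = num_nodes g"
          using eq root by simp
        \<comment> \<open>The induction hypothesis for \<open>g\<close> gives
          \<open>gmax g y \<le> cmax g y\<close>, so \<open>cmax g y\<close> is the last node of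
          \<open>g\<close> as well and is redirected.\<close>
        moreover have "kreweras (num_nodes g) (gmax g) (cmax g)"
          unfolding kreweras_def using noncrossing_gmax noncrossing_cmax Node.IH(2) by blast
        then have "gmax g y \<le> cmax g y"
          using kreweras_le green(1) by blast
        ultimately have "Suc (cmax g y) = num_nodes g"
          using le_cmax[OF green(1)] by linarith
        then show ?thesis using root green by simp
      qed (use root eq that in auto)
    next
      case i: (green y)
      from j show ?thesis
      proof (cases rule: node_cases)
        case (green z)
        then have "cmax g y = cmax g z"
          using i eq IH(2)[of y z] by simp
        then show ?thesis using i green by simp
      next
        case (red z)
        then show ?thesis
          using i eq noncrossingD(2)[OF noncrossing_gmax i(1)] by simp
      qed (use i that in auto)
    next
      case i: (red y)
      from j show ?thesis
      proof (cases rule: node_cases)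
        case (red z)
        then show ?thesis using i eq IH(3)[of y z] by simp
      qed (use i that in auto)
    qed
    show ?case
    proof (intro allI impI)
      fix i j assume "i < num_nodes ?T" "j < num_nodes ?T" "gmax ?T i = gmax ?T j"
      then show "cmax ?T i = cmax ?T j"
        using wlog[of i j] wlog[of j i] nat_le_linear[of i j] by argo
    qed
  qed simp
qed

section \<open>A tree is determined by its two functions\<close>

lemma cmax_less_last: "x < num_nodes b \<Longrightarrow> cmax (Node b g r) x < num_nodes b"
  using le_cmax[of x b] by simp

lemma tree_eqI:
  assumes "num_nodes T = num_nodes T'"
    and "\<And>x. x < num_nodes T \<Longrightarrow> gmax T x = gmax T' x \<and> cmax T x = cmax T' x"
  shows "T = T'"
  using assms
proof (induction T arbitrary: T')
  case Empty
  then show ?case by (metis num_nodes_eq_0_iff)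
next
  case (Node b g r)
  let ?T = "Node b g r"
  obtain b' g' r' where T': "T' = Node b' g' r'"
    using Node.prems(1) by (cases T') auto
  have N: "num_nodes b + num_nodes g + num_nodes r = num_nodes b' + num_nodes g' + num_nodes r'"
    using Node.prems(1) T' by simp
  have eq: "gmax (Node b g r) x = gmax (Node b' g' r') x" "cmax (Node b g r) x = cmax (Node b' g' r') x"
    if "x \<le> num_nodes b + num_nodes g + num_nodes r" for x
    using Node.prems(2)[of x] that T' by simp_all
  \<comment> \<open>Otherwise the root of the first tree would carry the label of a blue node of the
    second, whose \<open>cmax\<close> value falls short of the last node.\<close>
  have "\<not> num_nodes b < num_nodes b'"
    using cmax_less_last[of "num_nodes b" b' g' r'] eq(2)[of "num_nodes b"] N by fastforce
  moreover have "\<not> num_nodes b' < num_nodes b"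
    using cmax_less_last[of "num_nodes b'" b g r] eq(2)[of "num_nodes b'"] N by fastforce
  ultimately have B: "num_nodes b' = num_nodes b"
    by simp
  have G: "num_nodes g' = num_nodes g"
    using eq(1)[of "num_nodes b"] gmax_Node(2)[of b' g' r'] unfolding B by simp
  with B N have D: "num_nodes r' = num_nodes r"
    by simp
  note gm = gmax_Node[where b = b' and g = g' and r = r', unfolded B G]
  note cm = cmax_Node[where b = b' and g = g' and r = r', unfolded B G D]
  have "b = b'"
  proof (rule Node.IH(1))
    show "gmax b x = gmax b' x \<and> cmax b x = cmax b' x" if "x < num_nodes b" for x
      using eq[of x] that gm(1) cm(1) by simp
  qed (simp add: B)
  moreover have "g = g'"
  proof (rule Node.IH(2))
    show "gmax g x = gmax g' x \<and> cmax g x = cmax g' x" if "x < num_nodes g" for x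
    proof -
      have x: "Suc (num_nodes b + x) \<le> num_nodes b + num_nodes g + num_nodes r"
        using that by simp
      \<comment> \<open>A value that is not redirected stays strictly below the last green label, so
        it cannot be confused with a redirected one and \<open>cmax g\<close> can be
        recovered.\<close>
      have "cmax g x < num_nodes g" "cmax g' x < num_nodes g"
        using le_cmax[of x g] le_cmax[of x g'] that G by simp_all
      then have "cmax g x = cmax g' x"
        using eq(2)[OF x] that unfolding cmax_Node(3)[OF that] cm(3)[OF that]
        by (simp split: if_splits)
      then show ?thesis
        using eq(1)[OF x] unfolding gmax_Node(3)[OF that] gm(3)[OF that] by simp
    qed
  qed (simp add: G)
  moreover have "r = r'"
  proof (rule Node.IH(3))
    show "gmax r x = gmax r' x \<and> cmax r x = cmax r' x" if "x < num_nodes r" for x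
      using eq[of "Suc (num_nodes b + num_nodes g + x)"] that gm(4) cm(4) by simp
  qed (simp add: D)
  ultimately show ?case using T' by simp
qed

text \<open>For surjectivity: the restriction to \<open>K\<close> consecutive points starting at
  \<open>k\<close>, moved to 0, with values cut off at the last point \<open>k + K - 1\<close>.
  Cutting off is monotone and thus preserves nesting.\<close>

lemma noncrossing_window:
  assumes "noncrossing N p" "k + K \<le> N"
  shows "noncrossing K (\<lambda>x. min (p (k + x)) (k + K - 1) - k)"
  unfolding noncrossing_def
proof (intro allI impI conjI)
  fix i assume i: "i < K"
  then have "k + i < N" using assms(2) by simp
  note p = noncrossingD[OF assms(1) this]
  show "i \<le> min (p (k + i)) (k + K - 1) - k"
    using p(1) i by simp
  show "min (p (k + i)) (k + K - 1) - k < K"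
    using i by simp
  fix j assume "i \<le> j" "j \<le> min (p (k + i)) (k + K - 1) - k"
  then have "p (k + j) \<le> p (k + i)"
    using p(1) i by (intro p(3)) auto
  then show "min (p (k + j)) (k + K - 1) - k \<le> min (p (k + i)) (k + K - 1) - k"
    by (simp add: min.coboundedI1 diff_le_mono min.mono)
qed

text \<open>Values of \<open>p\<close> that agree after the cut either agreed before or both reach
  the right end. In the second case the values of \<open>p'\<close>, being at least as large, reach
  it too and are cut to the same point.\<close>

lemma kreweras_window:
  assumes "kreweras N p p'" "k + K \<le> N"
  shows "kreweras K (\<lambda>x. min (p (k + x)) (k + K - 1) - k) (\<lambda>x. min (p' (k + x)) (k + K - 1) - k)"
proof -
  have nc: "noncrossing N p" "noncrossing N p'"
    using assms(1) unfolding kreweras_def by blast+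
  have "min (p' (k + i)) (k + K - 1) - k = min (p' (k + j)) (k + K - 1) - k"
    if i: "i < K" and j: "j < K"
      and eq: "min (p (k + i)) (k + K - 1) - k = min (p (k + j)) (k + K - 1) - k" for i j
  proof -
    have N: "k + i < N" "k + j < N"
      using i j assms(2) by simp_all
    have "k + i \<le> p (k + i)" "k + j \<le> p (k + j)"
      using noncrossingD(1)[OF nc(1)] N by blast+
    then consider "p (k + i) = p (k + j)" | "k + K - 1 \<le> p (k + i)" "k + K - 1 \<le> p (k + j)"
      using eq i j by (auto simp: min_def split: if_splits)
    then show ?thesis
    proof cases
      case 1
      then have "p' (k + i) = p' (k + j)"
        using assms(1) N unfolding kreweras_def by blast
      then show ?thesis by simp
    next
      case 2
      then show ?thesis
        using kreweras_le[OF assms(1) N(1)] kreweras_le[OF assms(1) N(2)] by linarith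
    qed
  qed
  then show ?thesis
    unfolding kreweras_def using noncrossing_window[OF nc(1) assms(2)] noncrossing_window[OF nc(2) assms(2)]
    by blast
qed

text \<open>Surjectivity, by strong induction on the number of points: the windows for the three
  subtrees omit the root and are therefore shorter.\<close>

lemma kreweras_imp_ex_tree:
  "kreweras N p p' \<Longrightarrow>
    \<exists>T. num_nodes T = N \<and> (\<forall>x<N. gmax T x = p x \<and> cmax T x = p' x)"
proof (induction N arbitrary: p p' rule: less_induct)
  case (less N)
  show ?case
  proof (cases N)
    case 0
    then show ?thesis by (intro exI[of _ Empty]) simp
  next
    case (Suc M)
    have "noncrossing N p" "noncrossing N p'"
      using less.prems unfolding kreweras_def by blast+
    note nc = noncrossingD[OF this(1), unfolded Suc less_Suc_eq_le]
      and nc' = noncrossingD[OF this(2), unfolded Suc less_Suc_eq_le]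
    have M: "p' M = M"
      using nc'(1,2)[of M] by simp
    \<comment> \<open>\<open>B\<close> will be the label of the root; the fixed point
      \<open>M\<close> shows that the minimum exists. Below, \<open>G\<close> is read off from
      \<open>p B\<close>, and \<open>D\<close> is what remains up to \<open>M\<close>.\<close>
    define B where "B = (LEAST x. p' x = M)"
    have BM: "B \<le> M"
      unfolding B_def by (rule Least_le) (rule M)
    have p'B: "p' B = M"
      unfolding B_def by (rule LeastI) (rule M)
    have least: "p' x \<noteq> M" if "x < B" for x
      using not_less_Least[of x "\<lambda>x. p' x = M"] that by (simp add: B_def)
    obtain G where pB: "p B = B + G"
      using le_Suc_ex[OF nc(1)[OF BM]] by blast
    obtain D where MD: "M = B + G + D"
      using le_Suc_ex[OF nc(2)[OF BM]] pB by auto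
    \<comment> \<open>The last green point shares its image under \<open>p\<close> with the root, so
      the Kreweras condition forces its image under \<open>p'\<close> to be
      \<open>M\<close>.\<close>
    have "p (B + G) = p B"
      using noncrossing_idem[OF \<open>noncrossing N p\<close>, of B] BM Suc pB by simp
    then have "p' (B + G) = p' B"
      using less.prems MD Suc unfolding kreweras_def by auto
    then have p'BG: "p' (B + G) = M"
      using p'B by simp
    have p'_blue: "p' x < B" if "x < B" for x
    proof (rule ccontr)
      assume "\<not> p' x < B"
      \<comment> \<open>The interval of \<open>x\<close> would contain \<open>B\<close>, so
        \<open>p' x\<close> would be \<open>M\<close>, against the minimality of
        \<open>B\<close>.\<close>
      then have "p' B \<le> p' x"
        using that BM by (intro nc'(3)) auto
      then show False
        using least[OF that] nc'(2)[of x] that BM p'B by simp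
    qed
    have p_blue: "p x < B" if "x < B" for x
      using kreweras_le[OF less.prems, of x] p'_blue[OF that] that BM Suc by simp
    have p_green: "x \<le> p x" "p x \<le> B + G" "x \<le> p' x" "p' x = M \<or> p' x < B + G"
      if x: "B \<le> x" "x \<le> B + G" for x
    proof -
      have xM: "x \<le> M" using x MD by simp
      show "x \<le> p x" "x \<le> p' x" using nc(1) nc'(1) xM by blast+
      show "p x \<le> B + G"
        using nc(3)[OF BM x(1)] x(2) pB by simp
      show "p' x = M \<or> p' x < B + G"
        \<comment> \<open>If \<open>p' x\<close> reaches \<open>B + G\<close>, nesting lifts it to
          \<open>p' (B + G) = M\<close>.\<close>
        using nc'(3)[OF xM x(2)] nc'(2)[OF xM] p'BG by linarith
    qed
    have "B < N" "0 + B \<le> N" "G < N" "Suc B + G \<le> N" "D < N" "Suc (B + G) + D \<le> N"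
      using Suc MD by simp_all
    note IH = less.IH[OF this(1) kreweras_window[OF less.prems this(2)]]
      less.IH[OF this(3) kreweras_window[OF less.prems this(4)]]
      less.IH[OF this(5) kreweras_window[OF less.prems this(6)]]
    obtain b where b: "num_nodes b = B"
      "\<And>x. x < B \<Longrightarrow> gmax b x = min (p x) (B - 1) \<and> cmax b x = min (p' x) (B - 1)"
      using IH(1) by auto
    obtain g where g: "num_nodes g = G"
      "\<And>x. x < G \<Longrightarrow> gmax g x = min (p (Suc (B + x))) (B + G) - Suc B \<and>
        cmax g x = min (p' (Suc (B + x))) (B + G) - Suc B"
      using IH(2) by auto
    obtain r where r: "num_nodes r = D"
      "\<And>x. x < D \<Longrightarrow> gmax r x = min (p (Suc (B + G + x))) M - Suc (B + G) \<and>
        cmax r x = min (p' (Suc (B + G + x))) M - Suc (B + G)"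
      using IH(3) MD by auto
    note gN = gmax_Node[where b = b and g = g and r = r, unfolded b(1) g(1)]
      and cN = cmax_Node[where b = b and g = g and r = r, unfolded b(1) g(1) r(1)]
    have "gmax (Node b g r) x = p x \<and> cmax (Node b g r) x = p' x" if "x < N" for x
    proof -
      have "x < num_nodes (Node b g r)"
        using that Suc MD b(1) g(1) r(1) by simp
      then show ?thesis
      proof (cases rule: node_cases)
        case blue
        then show ?thesis
          using b p_blue[of x] p'_blue[of x] by simp
      next
        case root
        then show ?thesis
          using gN(2) cN(2) b(1) pB p'B MD by simp
      next
        case (green y)
        then have y: "y < G" "x = Suc (B + y)"
          using b(1) g(1) by simp_all
        have gm: "gmax (Node b g r) x = Suc (B + gmax g y)"
          and cm: "cmax (Node b g r) x = (if Suc (cmax g y) = G then M else Suc (B + cmax g y))"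
          using gN(3)[OF y(1)] cN(3)[OF y(1)] y(2) MD by simp_all
        have "B \<le> x" "x \<le> B + G"
          using y by simp_all
        note p_green = p_green[OF this]
        have "gmax (Node b g r) x = p x"
          unfolding gm using g(2)[OF y(1)] p_green(1,2) y(2) by simp
        \<comment> \<open>The cut at \<open>B + G\<close> turns the value \<open>M\<close> into the
          last green node, and the redirection in \<open>cmax\<close> restores it. Any other value
          is below \<open>B + G\<close>, so it is neither cut nor redirected.\<close>
        moreover have "cmax (Node b g r) x = p' x"
          unfolding cm using p_green(4)
        proof
          assume "p' x = M"
          then show "(if Suc (cmax g y) = G then M else Suc (B + cmax g y)) = p' x"
            using g(2)[OF y(1)] y MD by simp
        next
          assume "p' x < B + G"
          then show "(if Suc (cmax g y) = G then M else Suc (B + cmax g y)) = p' x"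
            using g(2)[OF y(1)] y p_green(3) by auto
        qed
        ultimately show ?thesis by simp
      next
        case (red y)
        then have y: "y < D" "x = Suc (B + G + y)"
          using b(1) g(1) r(1) by simp_all
        have gm: "gmax (Node b g r) x = Suc (B + G + gmax r y)"
          and cm: "cmax (Node b g r) x = Suc (B + G + cmax r y)"
          using gN(4) cN(4) y(2) by simp_all
        show ?thesis
          unfolding gm cm using r(2)[OF y(1)] y nc(1,2)[of x] nc'(1,2)[of x] MD by simp
      qed
    qed
    moreover have "num_nodes (Node b g r) = N"
      using Suc MD b(1) g(1) r(1) by simp
    ultimately show ?thesis by blast
  qed
qed

section \<open>The bijection between trees and pairs of relations\<close>

lemma rel_of_max_cong: "(\<And>i. i \<le> n \<Longrightarrow> p i = q i) \<Longrightarrow> rel_of_max n p = rel_of_max n q"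
  by (auto simp: rel_of_max_def)

lemma tree_pair_eq:
  assumes "num_nodes T = n + 1"
  shows "tree_pair n T = (rel_of_max n (gmax T), rel_of_max n (cmax T))"
  unfolding tree_pair_def
  using assms by (auto intro!: rel_of_max_cong simp: tree_max_eq_gmax tree_max'_eq_cmax)

lemma bij_betw_tree_pair:
  "bij_betw (tree_pair n) {T. num_nodes T = n + 1} {(R, R'). kreweras_pair n R R'}"
  unfolding bij_betw_def
proof (intro conjI inj_onI equalityI subsetI)
  fix T T'
  assume "T \<in> {T. num_nodes T = n + 1}" "T' \<in> {T. num_nodes T = n + 1}"
    and eq: "tree_pair n T = tree_pair n T'"
  then have N: "num_nodes T = n + 1" "num_nodes T' = n + 1"
    by simp_all
  have rel: "rel_of_max n (gmax T) = rel_of_max n (gmax T')"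
    "rel_of_max n (cmax T) = rel_of_max n (cmax T')"
    using eq by (simp_all add: tree_pair_eq N)
  have "gmax T x = gmax T' x \<and> cmax T x = cmax T' x" if "x \<le> n" for x
  proof -
    have "transfer_max (rel_of_max n (gmax U)) x = gmax U x"
      "transfer_max (rel_of_max n (cmax U)) x = cmax U x" if "num_nodes U = n + 1" for U
      using that \<open>x \<le> n\<close> noncrossingD(1)[OF noncrossing_gmax, of x U] le_cmax[of x U]
      by (simp_all add: transfer_max_rel_of_max)
    then show ?thesis using rel N by metis
  qed
  then show "T = T'"
    by (intro tree_eqI) (simp_all add: N)
next
  fix P assume "P \<in> tree_pair n ` {T. num_nodes T = n + 1}"
  then obtain T where "num_nodes T = n + 1" "P = tree_pair n T"
    by blast
  then show "P \<in> {(R, R'). kreweras_pair n R R'}"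
    using kreweras_imp_kreweras_pair[of n "gmax T" "cmax T"] kreweras_tree[of T]
    by (simp add: tree_pair_eq)
next
  fix P assume "P \<in> {(R, R'). kreweras_pair n R R'}"
  then obtain R R' where P: "P = (R, R')" "kreweras_pair n R R'"
    by blast
  obtain T where T: "num_nodes T = Suc n"
    "\<And>x. x \<le> n \<Longrightarrow> gmax T x = transfer_max R x \<and> cmax T x = transfer_max R' x"
    using kreweras_imp_ex_tree[OF kreweras_pair_imp_kreweras[OF P(2)]] less_Suc_eq_le by auto
  have "tree_pair n T = (rel_of_max n (transfer_max R), rel_of_max n (transfer_max R'))"
    using T by (auto simp: tree_pair_eq intro!: rel_of_max_cong)
  also have "\<dots> = P"
    using P by (simp add: kreweras_pair_def transfer_system_max(1))
  finally show "P \<in> tree_pair n ` {T. num_nodes T = n + 1}"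
    using T(1) by (intro image_eqI[of _ _ T]) simp_all
qed

section \<open>Weak equivalences\<close>

text \<open>Weak equivalences in terms of the maximum functions. The intermediate object is
  \<open>z\<close>; the condition on \<open>a\<close> expresses that
  \<open>x \<rightarrow> z\<close> is in the left class, as no relation leaving a point from
  \<open>x\<close> up to but excluding \<open>z\<close> reaches \<open>z\<close>.\<close>

definition weq :: "(nat \<Rightarrow> nat) \<Rightarrow> (nat \<Rightarrow> nat) \<Rightarrow> nat \<Rightarrow> nat \<Rightarrow> bool" where
  "weq p p' x y \<longleftrightarrow> (\<exists>z\<ge>x. z \<le> y \<and> y \<le> p z \<and> (\<forall>a. x \<le> a \<longrightarrow> a < z \<longrightarrow> p' a < z))"

lemma weak_equivs_rel_of_max:
  assumes "noncrossing (Suc n) p" "noncrossing (Suc n) p'" "x \<le> n"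
  shows "(x, y) \<in> weak_equivs n (rel_of_max n p) (rel_of_max n p') \<longleftrightarrow> y \<le> n \<and> weq p p' x y"
proof -
  note p = noncrossingD[OF assms(1), unfolded less_Suc_eq_le]
    and p' = noncrossingD[OF assms(2), unfolded less_Suc_eq_le]
  have left: "(x, z) \<in> left_class n (rel_of_max n p') \<longleftrightarrow>
      x \<le> z \<and> z \<le> n \<and> (\<forall>a. x \<le> a \<longrightarrow> a < z \<longrightarrow> p' a < z)" (is "?L \<longleftrightarrow> ?R") for z
  proof
    assume ?L
    then have xz: "x \<le> z" "z \<le> n"
      and lift: "\<And>a b. (a, b) \<in> rel_of_max n p' \<Longrightarrow> x \<le> a \<Longrightarrow> z \<le> b \<Longrightarrow> z \<le> a"
      unfolding left_class_def by blast+
    \<comment> \<open>Lifting is tested against the longest relation out of \<open>a\<close>: if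
      \<open>p' a\<close> were at least \<open>z\<close>, it would force
      \<open>z \<le> a\<close>.\<close>
    have "p' a < z" if "x \<le> a" "a < z" for a
      using lift[of a "p' a"] that xz p'(1)[of a] by (force simp: rel_of_max_def)
    with xz show ?R by blast
  next
    assume ?R
    then show ?L
      unfolding left_class_def rel_of_max_def by (auto simp flip: not_less)
  qed
  have "(x, y) \<in> weak_equivs n (rel_of_max n p) (rel_of_max n p') \<longleftrightarrow>
      (\<exists>z. (x, z) \<in> left_class n (rel_of_max n p') \<and> z \<le> n \<and> z \<le> y \<and> y \<le> p z)"
    unfolding weak_equivs_def rel_of_max_def by auto
  also have "\<dots> \<longleftrightarrow> y \<le> n \<and> weq p p' x y"
    unfolding left weq_def using p(2) by (meson le_trans)
  finally show ?thesis .
qed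

text \<open>Whether \<open>x \<rightarrow> y\<close> is a weak equivalence depends only on
  comparisons of values with points up to \<open>y\<close>. This weak form of agreement matters for
  the green subtree, where redirected \<open>cmax\<close> values differ from those of
  \<open>g\<close> but compare in the same way with all green nodes.\<close>

lemma weq_shift:
  assumes "\<And>i j. i \<le> j \<Longrightarrow> j \<le> y \<Longrightarrow> k + j \<le> p (k + i) \<longleftrightarrow> j \<le> q i"
    and "\<And>i j. i \<le> j \<Longrightarrow> j \<le> y \<Longrightarrow> k + j \<le> p' (k + i) \<longleftrightarrow> j \<le> q' i"
  shows "weq p p' (k + x) (k + y) \<longleftrightarrow> weq q q' x y"
proof
  assume "weq p p' (k + x) (k + y)"
  then obtain z where z: "k + x \<le> z" "z \<le> k + y" "k + y \<le> p z"
    and a: "\<And>a. k + x \<le> a \<Longrightarrow> a < z \<Longrightarrow> p' a < z"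
    unfolding weq_def by blast
  have "z = k + (z - k)" "x \<le> z - k" "z - k \<le> y"
    using z(1,2) by simp_all
  then obtain m where m: "z = k + m" "x \<le> m" "m \<le> y"
    by blast
  have "q' a < m" if "x \<le> a" "a < m" for a
    using a[of "k + a"] that assms(2)[of a m] m by (simp add: not_le[symmetric])
  then show "weq q q' x y"
    unfolding weq_def using assms(1)[of m y] m z(3) by blast
next
  assume "weq q q' x y"
  then obtain z where z: "x \<le> z" "z \<le> y" "y \<le> q z" and a: "\<And>a. x \<le> a \<Longrightarrow> a < z \<Longrightarrow> q' a < z"
    unfolding weq_def by blast
  have "p' c < k + z" if "k + x \<le> c" "c < k + z" for c
  proof -
    have "c = k + (c - k)" "x \<le> c - k" "c - k < z"
      using that by simp_all
    then obtain a where "c = k + a" "x \<le> a" "a < z"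
      by blast
    then show ?thesis
      using a[of a] z assms(2)[of a z] by (simp add: not_le[symmetric])
  qed
  then show "weq p p' (k + x) (k + y)"
    unfolding weq_def using assms(1)[of z y] z by (intro exI[of _ "k + z"]) simp
qed

section \<open>Weak equivalences of a tree in terms of its subtrees\<close>

abbreviation tree_weq :: "tricolored_tree \<Rightarrow> nat \<Rightarrow> nat \<Rightarrow> bool" where
  "tree_weq T \<equiv> weq (gmax T) (cmax T)"

lemma tree_weq_blue:
  assumes "y < num_nodes b"
  shows "tree_weq (Node b g r) x y \<longleftrightarrow> tree_weq b x y"
proof -
  have "tree_weq (Node b g r) (0 + x) (0 + y) \<longleftrightarrow> tree_weq b x y"
    by (rule weq_shift) (use assms in simp_all)
  then show ?thesis by simp
qed

lemma tree_weq_green: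
  assumes "y < num_nodes g"
  shows "tree_weq (Node b g r) (Suc (num_nodes b + x)) (Suc (num_nodes b + y)) \<longleftrightarrow> tree_weq g x y"
proof -
  have "tree_weq (Node b g r) (Suc (num_nodes b) + x) (Suc (num_nodes b) + y) \<longleftrightarrow> tree_weq g x y"
  proof (rule weq_shift)
    fix i j assume "i \<le> j" "j \<le> y"
    then have ij: "i < num_nodes g" "j < num_nodes g"
      using assms by simp_all
    then show "Suc (num_nodes b) + j \<le> gmax (Node b g r) (Suc (num_nodes b) + i) \<longleftrightarrow> j \<le> gmax g i"
      by simp
    show "Suc (num_nodes b) + j \<le> cmax (Node b g r) (Suc (num_nodes b) + i) \<longleftrightarrow> j \<le> cmax g i"
      using ij by auto
  qed
  then show ?thesis by simp
qed

lemma tree_weq_red: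
  "tree_weq (Node b g r) (Suc (num_nodes b + num_nodes g + x)) (Suc (num_nodes b + num_nodes g + y))
    \<longleftrightarrow> tree_weq r x y"
proof -
  let ?k = "Suc (num_nodes b + num_nodes g)"
  have "tree_weq (Node b g r) (?k + x) (?k + y) \<longleftrightarrow> tree_weq r x y"
    by (rule weq_shift) simp_all
  then show ?thesis by simp
qed

text \<open>The intermediate object is the root: no blue node has a component reaching it, and its
  \<open>gmax\<close> interval covers the green block.\<close>

lemma tree_weq_root:
  assumes "x \<le> num_nodes b" "num_nodes b \<le> y" "y \<le> num_nodes b + num_nodes g"
  shows "tree_weq (Node b g r) x y"
  unfolding weq_def
proof (intro exI conjI allI impI)
  show "cmax (Node b g r) a < num_nodes b" if "a < num_nodes b" for a
    by (rule cmax_less_last) (rule that)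
qed (use assms in simp_all)

text \<open>An intermediate object up to the last green label has its \<open>gmax\<close> value
  there too, short of \<open>y\<close>. A later one violates the left class condition at the label
  \<open>num_nodes b + num_nodes g\<close>, whose \<open>cmax\<close> value is the last node of the
  tree.\<close>

lemma not_tree_weq_red:
  assumes "x \<le> num_nodes b + num_nodes g" "num_nodes b + num_nodes g < y"
    "y < num_nodes (Node b g r)"
  shows "\<not> tree_weq (Node b g r) x y"
proof
  assume "tree_weq (Node b g r) x y"
  then obtain z where z: "x \<le> z" "z \<le> y" "y \<le> gmax (Node b g r) z"
    and a: "\<And>a. x \<le> a \<Longrightarrow> a < z \<Longrightarrow> cmax (Node b g r) a < z"
    unfolding weq_def by blast
  \<comment> \<open>If \<open>g\<close> is empty this node is the root; otherwise it is the last
    node of \<open>g\<close>, which \<open>cmax g\<close> fixes, so its value is redirected.\<close>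
  have last: "cmax (Node b g r) (num_nodes b + num_nodes g) = num_nodes b + num_nodes g + num_nodes r"
  proof (cases "num_nodes g")
    case (Suc m)
    then show ?thesis
      using cmax_Node(3)[of m g b r] le_cmax[of m g] by simp
  qed simp
  have "num_nodes b + num_nodes g < z"
  proof (rule ccontr)
    assume z_le: "\<not> num_nodes b + num_nodes g < z"
    have "z < num_nodes (Node b g r)"
      using z(2) assms(3) by simp
    then have "gmax (Node b g r) z \<le> num_nodes b + num_nodes g"
    proof (cases rule: node_cases)
      case blue
      then show ?thesis using noncrossingD(2)[OF noncrossing_gmax blue] by simp
    next
      case (green u)
      then show ?thesis using noncrossingD(2)[OF noncrossing_gmax green(1)] by simp
    qed (use z_le in auto)
    then show False using z(3) assms(2) by simp
  qed
  then have "num_nodes b + num_nodes g + num_nodes r < z"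
    using a[OF assms(1)] last by simp
  then show False using z(2) assms(3) by simp
qed

text \<open>If the red subtree is nonempty, the morphism from 0 to the last node is not a weak
  equivalence. If it is empty, every pair not inside the blue or the green subtree has the root
  between its ends (inclusive), and \<open>tree_weq_root\<close> applies.\<close>

lemma red_free_iff_tree_weq_total:
  "red_free T \<longleftrightarrow> (\<forall>x y. x \<le> y \<longrightarrow> y < num_nodes T \<longrightarrow> tree_weq T x y)"
proof (induction T)
  case (Node b g r)
  let ?tot = "\<lambda>T. \<forall>x y. x \<le> y \<longrightarrow> y < num_nodes T \<longrightarrow> tree_weq T x y"
  have "?tot (Node b g r) \<longleftrightarrow> ?tot b \<and> ?tot g \<and> r = Empty"
  proof
    assume tot: "?tot (Node b g r)"
    have "tree_weq b x y" if "x \<le> y" "y < num_nodes b" for x y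
      using tot[rule_format, of x y] that tree_weq_blue[of y b g r x] by simp
    moreover have "tree_weq g x y" if "x \<le> y" "y < num_nodes g" for x y
      using tot[rule_format, of "Suc (num_nodes b + x)" "Suc (num_nodes b + y)"] that
        tree_weq_green[of y g b r x] by simp
    moreover have "r = Empty"
    proof (rule ccontr)
      assume "r \<noteq> Empty"
      then have "0 < num_nodes r"
        by (cases r) simp_all
      then show False
        using tot[rule_format, of 0 "num_nodes b + num_nodes g + num_nodes r"]
          not_tree_weq_red[of 0 b g "num_nodes b + num_nodes g + num_nodes r" r] by simp
    qed
    ultimately show "?tot b \<and> ?tot g \<and> r = Empty" by blast
  next
    assume tot: "?tot b \<and> ?tot g \<and> r = Empty"
    show "?tot (Node b g r)"
    proof (intro allI impI)
      fix x y assume xy: "x \<le> y" "y < num_nodes (Node b g r)"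
      from xy(2) show "tree_weq (Node b g r) x y"
      proof (cases rule: node_cases)
        case blue
        then show ?thesis using tot xy(1) by (simp add: tree_weq_blue)
      next
        case root
        then show ?thesis using xy(1) by (simp add: tree_weq_root)
      next
        case y: (green v)
        have "x < num_nodes (Node b g r)"
          using xy by simp
        then show ?thesis
        proof (cases rule: node_cases)
          case (green u)
          then show ?thesis using y tot xy(1) by (simp add: tree_weq_green)
        qed (use y xy(1) tot in \<open>auto intro: tree_weq_root\<close>)
      next
        case red
        then show ?thesis using tot by simp
      qed
    qed
  qed
  with Node.IH show ?case by simp
qed simp

section \<open>Two-out-of-three and model structures\<close>

definition two_of_three :: "nat \<Rightarrow> (nat \<Rightarrow> nat \<Rightarrow> bool) \<Rightarrow> bool" where
  "two_of_three N W \<longleftrightarrow>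
    (\<forall>x y z. x \<le> y \<longrightarrow> y \<le> z \<longrightarrow> z < N \<longrightarrow>
      (W x y \<and> W y z \<longrightarrow> W x z) \<and> (W x y \<and> W x z \<longrightarrow> W y z) \<and> (W y z \<and> W x z \<longrightarrow> W x y))"

lemma two_of_threeD:
  assumes "two_of_three N W" "x \<le> y" "y \<le> z" "z < N"
  shows "W x y \<Longrightarrow> W x z \<Longrightarrow> W y z" "W y z \<Longrightarrow> W x z \<Longrightarrow> W x y"
  using assms unfolding two_of_three_def by blast+

lemma red_at_top_iff_two_of_three: "red_at_top T \<longleftrightarrow> two_of_three (num_nodes T) (tree_weq T)"
proof (induction T)
  case (Node b g r)
  let ?T = "Node b g r" and ?k = "num_nodes b + num_nodes g"
  have "two_of_three (num_nodes ?T) (tree_weq ?T) \<longleftrightarrow>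
      red_free b \<and> red_free g \<and> two_of_three (num_nodes r) (tree_weq r)" (is "?L \<longleftrightarrow> ?R")
  proof
    assume ?L
    note two = two_of_threeD[OF this]
    \<comment> \<open>The morphisms from \<open>x\<close> and from \<open>y\<close> to the root are
      weak equivalences, so two-out-of-three yields \<open>x \<rightarrow> y\<close>. For the green
      subtree the morphisms from the root play this role.\<close>
    have "tree_weq b x y" if "x \<le> y" "y < num_nodes b" for x y
      using two(2)[of x y "num_nodes b"] that tree_weq_blue[of y b g r x]
      by (simp add: tree_weq_root)
    moreover have "tree_weq g x y" if "x \<le> y" "y < num_nodes g" for x y
      using two(1)[of "num_nodes b" "Suc (num_nodes b + x)" "Suc (num_nodes b + y)"] that
        tree_weq_green[of y g b r x]
      by (simp add: tree_weq_root)
    moreover have "two_of_three (num_nodes r) (tree_weq r)"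
      unfolding two_of_three_def
    proof (intro allI impI)
      fix x y z assume "x \<le> y" "y \<le> z" "z < num_nodes r"
      then have "Suc (?k + x) \<le> Suc (?k + y)" "Suc (?k + y) \<le> Suc (?k + z)"
        "Suc (?k + z) < num_nodes ?T"
        by simp_all
      with \<open>?L\<close> show "(tree_weq r x y \<and> tree_weq r y z \<longrightarrow> tree_weq r x z) \<and>
          (tree_weq r x y \<and> tree_weq r x z \<longrightarrow> tree_weq r y z) \<and>
          (tree_weq r y z \<and> tree_weq r x z \<longrightarrow> tree_weq r x y)"
        unfolding two_of_three_def tree_weq_red[of b g r, symmetric] by blast
    qed
    ultimately show ?R by (simp add: red_free_iff_tree_weq_total)
  next
    assume R: ?R
    have top: "tree_weq ?T x y" if "x \<le> y" "y \<le> ?k" for x y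
    proof -
      have "y < num_nodes ?T"
        using that by simp
      then show ?thesis
      proof (cases rule: node_cases)
        case blue
        then show ?thesis
          using R that by (simp add: tree_weq_blue red_free_iff_tree_weq_total)
      next
        case root
        then show ?thesis using that by (simp add: tree_weq_root)
      next
        case y: (green v)
        have "x < num_nodes ?T"
          using that by simp
        then show ?thesis
        proof (cases rule: node_cases)
          case (green u)
          then show ?thesis
            using y R that by (simp add: tree_weq_green red_free_iff_tree_weq_total)
        qed (use y that in \<open>auto intro: tree_weq_root\<close>)
      qed (use that in simp)
    qed
    show ?L
      unfolding two_of_three_def
    proof (intro allI impI)
      fix x y z assume xyz: "x \<le> y" "y \<le> z" "z < num_nodes ?T"
      \<comment> \<open>Up to \<open>?k\<close> every morphism is a weak equivalence, and beyond it
        the red subtree decides. In the two mixed cases two of the three morphisms cross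
        \<open>?k\<close> and are not weak equivalences, so no premise of the three implications
        holds.\<close>
      consider "z \<le> ?k" | "x \<le> ?k" "y \<le> ?k" "?k < z" | "x \<le> ?k" "?k < y" "?k < z" | "?k < x"
        using xyz(1,2) by linarith
      then show "(tree_weq ?T x y \<and> tree_weq ?T y z \<longrightarrow> tree_weq ?T x z) \<and>
          (tree_weq ?T x y \<and> tree_weq ?T x z \<longrightarrow> tree_weq ?T y z) \<and>
          (tree_weq ?T y z \<and> tree_weq ?T x z \<longrightarrow> tree_weq ?T x y)"
      proof cases
        case 1
        then show ?thesis using top xyz(1,2) by simp
      next
        case 2
        then show ?thesis using not_tree_weq_red xyz(3) by blast
      next
        case 3
        then show ?thesis using not_tree_weq_red xyz by (meson le_less_trans)
      next
        case 4
        obtain u where u: "x = Suc (?k + u)"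
          using less_imp_Suc_add[OF 4] by blast
        obtain v where v: "y = Suc (?k + v)"
          using less_imp_Suc_add[of ?k y] 4 xyz(1) by auto
        obtain w where w: "z = Suc (?k + w)"
          using less_imp_Suc_add[of ?k z] 4 xyz(1,2) by auto
        have "u \<le> v" "v \<le> w" "w < num_nodes r"
          using xyz u v w by simp_all
        then show ?thesis
          unfolding u v w tree_weq_red using R unfolding two_of_three_def by blast
      qed
    qed
  qed
  with Node.IH show ?case by simp
qed (simp add: two_of_three_def)

lemma model_structure_tree_pair_iff:
  assumes "num_nodes T = n + 1"
  shows "model_structure n (fst (tree_pair n T)) (snd (tree_pair n T)) \<longleftrightarrow> red_at_top T"
proof -
  let ?R = "rel_of_max n (gmax T)" and ?R' = "rel_of_max n (cmax T)"
  have kr: "kreweras (Suc n) (gmax T) (cmax T)"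
    using kreweras_tree[of T] assms by simp
  then have nc: "noncrossing (Suc n) (gmax T)" "noncrossing (Suc n) (cmax T)"
    unfolding kreweras_def by blast+
  have "?R \<subseteq> ?R'"
  proof clarify
    fix i j assume "(i, j) \<in> ?R"
    then show "(i, j) \<in> ?R'"
      using kreweras_le[OF kr, of i] by (simp add: rel_of_max_def)
  qed
  then have "model_structure n ?R ?R' \<longleftrightarrow> two_out_of_three n (weak_equivs n ?R ?R')"
    unfolding model_structure_def using transfer_system_rel_of_max nc by blast
  also have "\<dots> \<longleftrightarrow> two_of_three (Suc n) (tree_weq T)"
    unfolding two_out_of_three_def two_of_three_def less_Suc_eq_le
    using weak_equivs_rel_of_max[OF nc] by (meson le_trans)
  also have "\<dots> \<longleftrightarrow> red_at_top T"
    using red_at_top_iff_two_of_three[of T] assms by simp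
  finally show ?thesis
    by (simp add: tree_pair_eq[OF assms])
qed

theorem theorem5p4:
  fixes n :: nat
  shows "bij_betw (tree_pair n) {T. num_nodes T = n + 1} {(R, R'). kreweras_pair n R R'}
    \<and> (\<forall>T. num_nodes T = n + 1 \<longrightarrow>
         (model_structure n (fst (tree_pair n T)) (snd (tree_pair n T))
          \<longleftrightarrow> \<not> has_red_descended_from_nonred T))"
  using bij_betw_tree_pair model_structure_tree_pair_iff has_red_descended_from_nonred_iff by simp

end
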